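(* Let $k$ be a field of characteristic $0$ and let $P=k((x))((\partial^{-1}))$ be the skew-field of formal pseudo-differential operators in one variable. Let $L,M\in P$ be operators of orders $\neq0$, each of the form $\partial^m+(\text{an operator of order}<m-1)$, where $m\neq 0$ is its order. Then the following conditions are equivalent: i) there is $S\in1+P_-$ such that $M=S^{-1}LS$; ii) $\mathrm{ord}(L)=\mathrm{ord}(M)=:r$, and for all $q\in\frac1r\mathbf Z$ $$\mathrm{res}_P(L^q)=\mathrm{res}_P(M^q).$$
   Context: $P=k((x))((\partial^{-1}))$ consists of formal expressions $\sum_{i\le N}a_i\partial^i$, $a_i\in k((x))$, with multiplication $(\sum_ia_i\partial^i)(\sum_jb_j\partial^j)=\sum_{i,j;\,l\ge0}\binom{i}{l}a_i\,d^l(b_j)\,\partial^{i+j-l}$, where $d=d/dx$. For $L=\sum_{i\le m}a_i\partial^i$ with $a_m\ne0$, $\mathrm{ord}(L)=m$; the zero operator is counted as having order less than any integer. $P_-$ is the set of operators of order $<0$ (including $0$). $\mathrm{res}_P(L)\in k$ is the coefficient at $x^{-1}\partial^{-1}$ of $L$, i.e. the coefficient of $x^{-1}$ in the coefficient of $\partial^{-1}$. Fractional powers: if $L$ has order $r\ne0$ and highest term $\partial^r$, there is a unique $N\in P$ with highest term $\partial$ such that $N^r=L$; for $q=j/r$, $j\in\mathbf Z$, put $L^q=N^j$. *)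

theory Defs
  imports "HOL-Computational_Algebra.Formal_Laurent_Series"
begin

text \<open>
  An operator is represented by its coefficients: the sequence \<open>a\<close> stands for the sum of the
  \<open>a i \<partial>\<^sup>i\<close>, with the coefficients to the left of the powers of \<open>\<partial>\<close>.
\<close>

typedef (overloaded) 'k pdo = "{a :: int \<Rightarrow> 'k::field_char_0 fls. \<exists>N. \<forall>i>N. a i = 0}"
  morphisms pdo_coeff Abs_pdo
  by (rule exI[of _ "\<lambda>_. 0"]) simp

setup_lifting type_definition_pdo

lemma pdo_coeff_bounded: "\<exists>N. \<forall>i>N. pdo_coeff A i = 0"
  using pdo_coeff[of A] by simp

text \<open>Multiplication collects all \<open>i, j, l\<close> contributing to \<open>\<partial>\<^sup>n\<close>.\<close>

definition pdo_mult_index ::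
    "(int \<Rightarrow> 'k::field_char_0 fls) \<Rightarrow> (int \<Rightarrow> 'k fls) \<Rightarrow> int \<Rightarrow> (int \<times> int \<times> nat) set" where
  "pdo_mult_index a b n = {(i, j, l). a i \<noteq> 0 \<and> b j \<noteq> 0 \<and> i + j - int l = n}"

lemma finite_pdo_mult_index:
  assumes "\<exists>N. \<forall>i>N. a i = 0" and "\<exists>N. \<forall>i>N. b i = 0"
  shows "finite (pdo_mult_index a b n)"
proof -
  obtain N K where N: "\<And>i. i > N \<Longrightarrow> a i = 0" and K: "\<And>i. i > K \<Longrightarrow> b i = 0"
    using assms by blast
  have "pdo_mult_index a b n \<subseteq> {n - K..N} \<times> {n - N..K} \<times> {..nat (N + K - n)}"
  proof
    fix t assume "t \<in> pdo_mult_index a b n"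
    then obtain i j l where t: "t = (i, j, l)" and h: "a i \<noteq> 0" "b j \<noteq> 0" "i + j - int l = n"
      by (auto simp: pdo_mult_index_def)
    have "i \<le> N" "j \<le> K" using h N[of i] K[of j] by (meson not_le)+
    with t h(3) show "t \<in> {n - K..N} \<times> {n - N..K} \<times> {..nat (N + K - n)}" by auto
  qed
  then show ?thesis by (rule finite_subset) simp
qed

instantiation pdo :: (field_char_0) "{zero, one, plus, minus, uminus, times}"
begin

lift_definition zero_pdo :: "'a pdo" is "\<lambda>_. 0" by simp

lift_definition one_pdo :: "'a pdo" is "\<lambda>i. if i = 0 then 1 else 0" by auto

lift_definition plus_pdo :: "'a pdo \<Rightarrow> 'a pdo \<Rightarrow> 'a pdo" is "\<lambda>a b i. a i + b i"
proof -
  fix a b :: "int \<Rightarrow> 'a fls"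
  assume "\<exists>N. \<forall>i>N. a i = 0" "\<exists>N. \<forall>i>N. b i = 0"
  then obtain N K where "\<forall>i>N. a i = 0" "\<forall>i>K. b i = 0" by blast
  then show "\<exists>N. \<forall>i>N. a i + b i = 0" by (intro exI[of _ "max N K"]) simp
qed

lift_definition minus_pdo :: "'a pdo \<Rightarrow> 'a pdo \<Rightarrow> 'a pdo" is "\<lambda>a b i. a i - b i"
proof -
  fix a b :: "int \<Rightarrow> 'a fls"
  assume "\<exists>N. \<forall>i>N. a i = 0" "\<exists>N. \<forall>i>N. b i = 0"
  then obtain N K where "\<forall>i>N. a i = 0" "\<forall>i>K. b i = 0" by blast
  then show "\<exists>N. \<forall>i>N. a i - b i = 0" by (intro exI[of _ "max N K"]) simp
qed

lift_definition uminus_pdo :: "'a pdo \<Rightarrow> 'a pdo" is "\<lambda>a i. - a i" by simp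

lift_definition times_pdo :: "'a pdo \<Rightarrow> 'a pdo \<Rightarrow> 'a pdo" is
  "\<lambda>a b n. \<Sum>(i, j, l)\<in>pdo_mult_index a b n.
     fls_const (of_int i gchoose l) * a i * (fls_deriv ^^ l) (b j)"
proof -
  fix a b :: "int \<Rightarrow> 'a fls"
  assume "\<exists>N. \<forall>i>N. a i = 0" "\<exists>N. \<forall>i>N. b i = 0"
  then obtain N K where N: "\<forall>i>N. a i = 0" and K: "\<forall>i>K. b i = 0" by blast
  have "pdo_mult_index a b n = {}" if "n > N + K" for n
  proof (rule ccontr)
    assume "pdo_mult_index a b n \<noteq> {}"
    then obtain i j l where h: "a i \<noteq> 0" "b j \<noteq> 0" "i + j - int l = n"
      by (auto simp: pdo_mult_index_def)
    have "i \<le> N" "j \<le> K" using h N K by (meson not_le)+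
    with h(3) that show False by simp
  qed
  then show "\<exists>N. \<forall>n>N. (\<Sum>(i, j, l)\<in>pdo_mult_index a b n.
      fls_const (of_int i gchoose l) * a i * (fls_deriv ^^ l) (b j)) = 0"
    by (intro exI[of _ "N + K"]) simp
qed

instance ..

end

instance pdo :: (field_char_0) power ..

text \<open>The inverse is the two-sided inverse, with the usual convention \<open>inverse 0 = 0\<close>.\<close>

instantiation pdo :: (field_char_0) inverse
begin

definition inverse_pdo :: "'a pdo \<Rightarrow> 'a pdo" where
  "inverse_pdo A =
     (if \<exists>B. A * B = 1 \<and> B * A = 1 then THE B. A * B = 1 \<and> B * A = 1 else 0)"

definition divide_pdo :: "'a pdo \<Rightarrow> 'a pdo \<Rightarrow> 'a pdo" where
  "divide_pdo A B = A * inverse B"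

instance ..

end

lift_definition pdo_del :: "int \<Rightarrow> 'k::field_char_0 pdo" is "\<lambda>m i. if i = m then 1 else 0"
  by auto

text \<open>Unspecified for the zero operator, hence the case distinction in \<open>pdo_ord_less\<close>.\<close>

definition pdo_ord :: "'k::field_char_0 pdo \<Rightarrow> int" where
  "pdo_ord A = (GREATEST i. pdo_coeff A i \<noteq> 0)"

definition pdo_ord_less :: "'k::field_char_0 pdo \<Rightarrow> int \<Rightarrow> bool" where
  "pdo_ord_less A n \<longleftrightarrow> A = 0 \<or> pdo_ord A < n"

definition pdo_neg :: "'k::field_char_0 pdo set" where
  "pdo_neg = {A. pdo_ord_less A 0}"

definition pdo_res :: "'k::field_char_0 pdo \<Rightarrow> 'k" where
  "pdo_res A = fls_residue (pdo_coeff A (-1))"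

definition pdo_highest_del :: "'k::field_char_0 pdo \<Rightarrow> int \<Rightarrow> bool" where
  "pdo_highest_del A m \<longleftrightarrow> (\<exists>R. pdo_ord_less R m \<and> A = pdo_del m + R)"

text \<open>The two descriptions below are used only for \<open>A\<close> of order \<open>r \<noteq> 0\<close> with highest term
  \<open>\<partial>\<^sup>r\<close> and for \<open>q\<close> in \<open>(1/r)\<int>\<close>; there they determine \<open>N\<close> and \<open>j\<close> uniquely.\<close>

definition pdo_root :: "'k::field_char_0 pdo \<Rightarrow> 'k pdo" where
  "pdo_root A = (THE N. pdo_highest_del N 1 \<and> N powi pdo_ord A = A)"

definition pdo_powq :: "'k::field_char_0 pdo \<Rightarrow> rat \<Rightarrow> 'k pdo" where
  "pdo_powq A q = pdo_root A powi (THE j. q = of_int j / of_int (pdo_ord A))"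

end

theory Submission
  imports Defs
begin

text \<open>
  The residue is a trace: \<open>res\<^sub>P(AB) = res\<^sub>P(BA)\<close> (lemma \<open>pdo_res_commute\<close>). It is therefore invariant
  under conjugation. If \<open>M = S\<^sup>-\<^sup>1LS\<close>, uniqueness of roots shows that the roots \<open>N\<close> of \<open>L\<close> and \<open>N'\<close> of \<open>M\<close>
  satisfy \<open>N' = S\<^sup>-\<^sup>1NS\<close>, so that all powers of \<open>N\<close> and \<open>N'\<close> have equal residues.

  Conversely it suffices to conjugate \<open>N\<close> into \<open>N'\<close>. Both have the form \<open>\<partial> +\<close> (order \<open>< 0\<close>), because
  \<open>L\<close> and \<open>M\<close> have no subleading term. Suppose that, after conjugating \<open>N\<close>, the difference is
  \<open>N - N' = c\<partial>\<^bsup>-m\<^esup> + \<dots>\<close> with \<open>m \<ge> 1\<close>. Conjugation by \<open>1 + s\<partial>\<^bsup>-m\<^esup>\<close> changes \<open>N\<close> by \<open>s'\<partial>\<^bsup>-m\<^esup> + \<dots>\<close>, so the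
  term can be removed if and only if \<open>c\<close> is a derivative, that is, \<open>c\<close> has no residue. Now
  \<open>N\<^sup>m - N'\<^sup>m = m c \<partial>\<^sup>-\<^sup>1 + \<dots>\<close> (lemma \<open>monic_power_diff\<close>), and the residues of the two powers agree.
  Hence the residue of \<open>c\<close> vanishes in characteristic 0. The successive conjugating operators
  converge, and their limit is the required \<open>S\<close> (lemma \<open>ex_conjugator\<close>).

  That \<open>P\<close> is a skew field and that monic operators of nonzero order \<open>r\<close> have unique monic roots of
  order 1 is shown with two tools: identities that are additive in each argument are reduced to
  monomials (lemma \<open>additive_eq_zero\<close>), and operators are constructed as limits in the filtration by
  order (lemma \<open>ord_le_limit\<close>).
\<close>

section \<open>Coefficients of a product\<close>

lemma pdo_eqI: "(\<And>i. pdo_coeff A i = pdo_coeff B i) \<Longrightarrow> A = B"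
  by (metis ext pdo_coeff_inject)

lemma coeff_zero [simp]: "pdo_coeff 0 i = 0"
  by (simp add: zero_pdo.rep_eq)

lemma coeff_one: "pdo_coeff 1 i = (if i = 0 then 1 else 0)"
  by (simp add: one_pdo.rep_eq)

lemma coeff_add [simp]: "pdo_coeff (A + B) i = pdo_coeff A i + pdo_coeff B i"
  by (simp add: plus_pdo.rep_eq)

lemma coeff_diff [simp]: "pdo_coeff (A - B) i = pdo_coeff A i - pdo_coeff B i"
  by (simp add: minus_pdo.rep_eq)

lemma coeff_uminus [simp]: "pdo_coeff (- A) i = - pdo_coeff A i"
  by (simp add: uminus_pdo.rep_eq)

lemma coeff_del: "pdo_coeff (pdo_del m) i = (if i = m then 1 else 0)"
  by (simp add: pdo_del.rep_eq)

instance pdo :: (field_char_0) ab_group_add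
  by standard (auto intro!: pdo_eqI)

definition pdo_mon :: "'k::field_char_0 fls \<Rightarrow> int \<Rightarrow> 'k pdo" where
  "pdo_mon a m = Abs_pdo (\<lambda>i. if i = m then a else 0)"

lemma coeff_mon: "pdo_coeff (pdo_mon a m) i = (if i = m then a else 0)"
  unfolding pdo_mon_def by (subst Abs_pdo_inverse) auto

text \<open>
  The zero operator satisfies every bound, so that sums and products obey the bounds with no case
  distinction; this is the filtration of \<open>P\<close> by order.
\<close>

definition pdo_ord_le :: "'k::field_char_0 pdo \<Rightarrow> int \<Rightarrow> bool" where
  "pdo_ord_le A n \<longleftrightarrow> (\<forall>i>n. pdo_coeff A i = 0)"

lemma ord_leD: "pdo_ord_le A n \<Longrightarrow> n < i \<Longrightarrow> pdo_coeff A i = 0"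
  by (simp add: pdo_ord_le_def)

lemma ex_ord_le: "\<exists>N. pdo_ord_le A N"
  using pdo_coeff_bounded[of A] by (simp add: pdo_ord_le_def)

lemma ord_le_mono: "pdo_ord_le A m \<Longrightarrow> m \<le> n \<Longrightarrow> pdo_ord_le A n"
  by (simp add: pdo_ord_le_def)

lemma ord_le_zero [simp]: "pdo_ord_le 0 n"
  by (simp add: pdo_ord_le_def)

lemma ord_le_one: "0 \<le> n \<Longrightarrow> pdo_ord_le 1 n"
  by (simp add: pdo_ord_le_def coeff_one)

lemma ord_le_mon: "m \<le> n \<Longrightarrow> pdo_ord_le (pdo_mon a m) n"
  by (simp add: pdo_ord_le_def coeff_mon)

lemma ord_le_add: "pdo_ord_le A n \<Longrightarrow> pdo_ord_le B n \<Longrightarrow> pdo_ord_le (A + B) n"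
  by (simp add: pdo_ord_le_def)

lemma ord_le_diff: "pdo_ord_le A n \<Longrightarrow> pdo_ord_le B n \<Longrightarrow> pdo_ord_le (A - B) n"
  by (simp add: pdo_ord_le_def)

lemma ord_le_uminus [simp]: "pdo_ord_le (- A) n \<longleftrightarrow> pdo_ord_le A n"
  by (simp add: pdo_ord_le_def)

lemma ord_le_lower: "pdo_ord_le A n \<Longrightarrow> pdo_coeff A n = 0 \<Longrightarrow> pdo_ord_le A (n - 1)"
  unfolding pdo_ord_le_def by (metis add_diff_cancel_right' linorder_neqE not_less zle_diff1_eq
      zless_imp_add1_zle diff_add_cancel le_less)

lemma zero_if_ord_le_all:
  assumes "\<And>m::nat. pdo_ord_le A (e - int m)"
  shows "A = 0"
proof (rule pdo_eqI)
  fix i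
  have "pdo_ord_le A (e - int (nat (e - i + 1)))" by (rule assms)
  then show "pdo_coeff A i = pdo_coeff 0 i" by (auto dest!: ord_leD[where i = i])
qed

lemma fls_deriv_iter_zero [simp]: "(fls_deriv ^^ l) 0 = 0"
  by (induction l) simp_all

lemma fls_deriv_iter_add:
  "(fls_deriv ^^ l) (f + g :: 'k::field_char_0 fls) = (fls_deriv ^^ l) f + (fls_deriv ^^ l) g"
  by (induction l) simp_all

text \<open>
  The index \<open>j\<close> is determined by \<open>i\<close>, \<open>l\<close> and \<open>n\<close>. Any finite index set containing the support may
  be used, since it has to be the same for \<open>A\<close>, \<open>B\<close> and \<open>A + B\<close> when distributivity is proved, and
  is a single line of indices when one factor is a monomial.
\<close>

lemma coeff_mult:
  fixes A B :: "'k::field_char_0 pdo"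
  assumes X: "finite X"
    and supp: "\<And>i l. pdo_coeff A i \<noteq> 0 \<Longrightarrow> pdo_coeff B (n - i + int l) \<noteq> 0 \<Longrightarrow> (i, l) \<in> X"
  shows "pdo_coeff (A * B) n = (\<Sum>(i, l)\<in>X. fls_const (of_int i gchoose l) * pdo_coeff A i
    * (fls_deriv ^^ l) (pdo_coeff B (n - i + int l)))"
proof -
  let ?Y = "{(i, l). pdo_coeff A i \<noteq> 0 \<and> pdo_coeff B (n - i + int l) \<noteq> 0}"
  have "?Y \<subseteq> X" using supp by auto
  have j: "i + j - int l = n \<longleftrightarrow> j = n - i + int l" for i j l by arith
  have "pdo_coeff (A * B) n = (\<Sum>(i, l)\<in>?Y. fls_const (of_int i gchoose l) * pdo_coeff A i
    * (fls_deriv ^^ l) (pdo_coeff B (n - i + int l)))"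
    unfolding times_pdo.rep_eq
    by (rule sum.reindex_bij_witness[where i = "\<lambda>(i, l). (i, n - i + int l, l)"
          and j = "\<lambda>(i, j, l). (i, l)"])
       (auto simp: pdo_mult_index_def j)
  also have "\<dots> = (\<Sum>(i, l)\<in>X. fls_const (of_int i gchoose l) * pdo_coeff A i
    * (fls_deriv ^^ l) (pdo_coeff B (n - i + int l)))"
    by (rule sum.mono_neutral_left[OF X \<open>?Y \<subseteq> X\<close>]) auto
  finally show ?thesis .
qed

lemma coeff_mult_box:
  assumes "pdo_ord_le A N" and "pdo_ord_le B K"
  shows "pdo_coeff (A * B) n = (\<Sum>(i, l)\<in>{n - K..N} \<times> {..nat (N + K - n)}.
    fls_const (of_int i gchoose l) * pdo_coeff A i
    * (fls_deriv ^^ l) (pdo_coeff B (n - i + int l)))"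
proof (rule coeff_mult)
  fix i l assume "pdo_coeff A i \<noteq> 0" "pdo_coeff B (n - i + int l) \<noteq> 0"
  then have "i \<le> N" "n - i + int l \<le> K"
    using assms unfolding pdo_ord_le_def by (meson not_le)+
  then show "(i, l) \<in> {n - K..N} \<times> {..nat (N + K - n)}" by auto
qed simp

lemma coeff_mon_mult:
  assumes "pdo_ord_le B (n - m + int T)"
  shows "pdo_coeff (pdo_mon a m * B) n =
    (\<Sum>l\<le>T. fls_const (of_int m gchoose l) * a * (fls_deriv ^^ l) (pdo_coeff B (n - m + int l)))"
proof -
  have "pdo_coeff (pdo_mon a m * B) n = (\<Sum>(i, l)\<in>Pair m ` {..T}.
    fls_const (of_int i gchoose l) * pdo_coeff (pdo_mon a m) i
    * (fls_deriv ^^ l) (pdo_coeff B (n - i + int l)))"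
  proof (rule coeff_mult)
    fix i l assume "pdo_coeff (pdo_mon a m) i \<noteq> 0" "pdo_coeff B (n - i + int l) \<noteq> 0"
    then have "i = m" "\<not> n - m + int T < n - m + int l"
      using ord_leD[OF assms, of "n - m + int l"] by (auto simp: coeff_mon split: if_splits)
    then show "(i, l) \<in> Pair m ` {..T}" by auto
  qed simp
  then show ?thesis by (simp add: sum.reindex inj_on_def coeff_mon)
qed

lemma coeff_mult_mon:
  assumes "pdo_ord_le A (n - m + int T)"
  shows "pdo_coeff (A * pdo_mon b m) n =
    (\<Sum>l\<le>T. fls_const (of_int (n - m + int l) gchoose l) * pdo_coeff A (n - m + int l)
      * (fls_deriv ^^ l) b)"
proof -
  have "pdo_coeff (A * pdo_mon b m) n = (\<Sum>(i, l)\<in>(\<lambda>l. (n - m + int l, l)) ` {..T}.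
    fls_const (of_int i gchoose l) * pdo_coeff A i
    * (fls_deriv ^^ l) (pdo_coeff (pdo_mon b m) (n - i + int l)))"
  proof (rule coeff_mult)
    fix i l assume "pdo_coeff A i \<noteq> 0" "pdo_coeff (pdo_mon b m) (n - i + int l) \<noteq> 0"
    then have "i = n - m + int l" "\<not> n - m + int T < i"
      using ord_leD[OF assms, of i] by (auto simp: coeff_mon split: if_splits)
    then show "(i, l) \<in> (\<lambda>l. (n - m + int l, l)) ` {..T}" by auto
  qed simp
  then show ?thesis by (simp add: sum.reindex inj_on_def coeff_mon)
qed

lemma coeff_mon_mult_mon:
  "pdo_coeff (pdo_mon a i * pdo_mon b j) n =
    (if n \<le> i + j then fls_const (of_int i gchoose nat (i + j - n)) * a
        * (fls_deriv ^^ nat (i + j - n)) b else 0)"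
proof (cases "n \<le> i + j")
  case True
  then have "pdo_coeff (pdo_mon a i * pdo_mon b j) n = (\<Sum>l\<le>nat (i + j - n).
      fls_const (of_int i gchoose l) * a
      * (fls_deriv ^^ l) (pdo_coeff (pdo_mon b j) (n - i + int l)))"
    by (intro coeff_mon_mult ord_le_mon) simp
  also have "\<dots> = (\<Sum>l\<in>{nat (i + j - n)}. fls_const (of_int i gchoose l) * a
      * (fls_deriv ^^ l) (pdo_coeff (pdo_mon b j) (n - i + int l)))"
    using True by (intro sum.mono_neutral_right) (auto simp: coeff_mon)
  finally show ?thesis using True by (simp add: coeff_mon)
next
  case False
  then show ?thesis
    using coeff_mult_box[OF ord_le_mon[of i i a] ord_le_mon[of j j b], of n] by simp
qed

lemma pdo_distrib_right: "(A + B) * C = A * C + B * (C :: 'k::field_char_0 pdo)"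
proof (rule pdo_eqI)
  fix n
  obtain N1 N2 K where h: "pdo_ord_le A N1" "pdo_ord_le B N2" and K: "pdo_ord_le C K"
    using ex_ord_le by metis
  define N where "N = max N1 N2"
  have A: "pdo_ord_le A N" and B: "pdo_ord_le B N"
    using h by (auto simp: N_def intro: ord_le_mono)
  show "pdo_coeff ((A + B) * C) n = pdo_coeff (A * C + B * C) n"
    by (simp add: coeff_mult_box[OF A K] coeff_mult_box[OF B K]
        coeff_mult_box[OF ord_le_add[OF A B] K] algebra_simps
        case_prod_unfold flip: sum.distrib)
qed

lemma pdo_distrib_left: "A * (B + C) = A * B + A * (C :: 'k::field_char_0 pdo)"
proof (rule pdo_eqI)
  fix n
  obtain N K1 K2 where N: "pdo_ord_le A N" and h: "pdo_ord_le B K1" "pdo_ord_le C K2"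
    using ex_ord_le by metis
  define K where "K = max K1 K2"
  have B: "pdo_ord_le B K" and C: "pdo_ord_le C K"
    using h by (auto simp: K_def intro: ord_le_mono)
  show "pdo_coeff (A * (B + C)) n = pdo_coeff (A * B + A * C) n"
    by (simp add: coeff_mult_box[OF N B] coeff_mult_box[OF N C]
        coeff_mult_box[OF N ord_le_add[OF B C]] algebra_simps fls_deriv_iter_add
        case_prod_unfold flip: sum.distrib)
qed

lemma ord_le_mult:
  assumes "pdo_ord_le A N" and "pdo_ord_le B K" and "N + K \<le> n"
  shows "pdo_ord_le (A * B) n"
  unfolding pdo_ord_le_def using assms(3) by (auto simp: coeff_mult_box[OF assms(1,2)])

lemma coeff_mult_top:
  assumes "pdo_ord_le A N" and "pdo_ord_le B K"
  shows "pdo_coeff (A * B) (N + K) = pdo_coeff A N * pdo_coeff B K"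
  by (simp add: coeff_mult_box[OF assms])

section \<open>The ring of pseudo-differential operators\<close>

text \<open>
  A density argument: modulo operators of low order, every operator is a finite sum of monomials.
  Multilinear identities of operators whose coefficients depend on finitely many coefficients of
  the arguments are therefore reduced to monomials \<open>a\<partial>\<^sup>i\<close>. Both associativity and the trace
  property of the residue are obtained in this way.
\<close>

lemma additive_eq_zero:
  fixes f :: "'k::field_char_0 pdo \<Rightarrow> 'b::ab_group_add"
  assumes add: "\<And>A B. f (A + B) = f A + f B"
    and mon: "\<And>a i. f (pdo_mon a i) = 0"
    and low: "\<exists>e. \<forall>A. pdo_ord_le A e \<longrightarrow> f A = 0"
  shows "f A = 0"
proof -
  obtain e where e: "\<And>A. pdo_ord_le A e \<Longrightarrow> f A = 0" using low by blast
  have *: "f A = 0" if "pdo_ord_le A (e + int m)" for A m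
    using that
  proof (induction m arbitrary: A)
    case 0
    then show ?case by (simp add: e)
  next
    case (Suc m)
    let ?T = "pdo_mon (pdo_coeff A (e + int (Suc m))) (e + int (Suc m))"
    have "pdo_ord_le (A - ?T) (e + int (Suc m))"
      using Suc.prems by (intro ord_le_diff ord_le_mon) auto
    then have "pdo_ord_le (A - ?T) (e + int (Suc m) - 1)"
      by (rule ord_le_lower) (simp add: coeff_mon)
    then have "f (A - ?T) = 0" by (intro Suc.IH) simp
    then show ?case using add[of "A - ?T" ?T] mon by simp
  qed
  obtain N where "pdo_ord_le A N" using ex_ord_le by blast
  then have "pdo_ord_le A (e + int (nat (N - e)))" by (rule ord_le_mono) simp
  then show ?thesis by (rule *)
qed

lemma fls_deriv_iter_mult:
  fixes f g :: "'k::field_char_0 fls"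
  shows "(fls_deriv ^^ n) (f * g) =
    (\<Sum>s\<le>n. fls_const (of_nat n gchoose s) * (fls_deriv ^^ s) f * (fls_deriv ^^ (n - s)) g)"
proof (induction n)
  case (Suc n)
  let ?D = "\<lambda>l. fls_deriv ^^ l"
  have d: "fls_deriv (fls_const c * x) = fls_const c * fls_deriv x" for c and x :: "'k fls"
    by (simp add: fls_deriv_mult_const_left)
  have "?D (Suc n) (f * g) = (\<Sum>s\<le>n. fls_const (of_nat (n choose s)) * ?D s f * ?D (Suc n - s) g) +
      (\<Sum>s\<le>n. fls_const (of_nat (n choose s)) * ?D (Suc s) f * ?D (n - s) g)"
    by (simp add: Suc.IH fls_deriv_sum mult.assoc d flip: sum.distrib binomial_gbinomial)
       (simp add: algebra_simps Suc_diff_le)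
  also have "\<dots> = (\<Sum>s\<le>Suc n. fls_const (of_nat (n choose s)) * ?D s f * ?D (Suc n - s) g) +
      (\<Sum>s\<le>n. fls_const (of_nat (n choose s)) * ?D (Suc s) f * ?D (n - s) g)"
    by simp
  also have "\<dots> = f * ?D (Suc n) g + (\<Sum>s\<le>n. fls_const (of_nat (Suc n choose Suc s)) * ?D (Suc s) f * ?D (n - s) g)"
    unfolding sum.atMost_Suc_shift
    by (simp add: algebra_simps flip: sum.distrib fls_plus_const)
  also have "\<dots> = (\<Sum>s\<le>Suc n. fls_const (of_nat (Suc n choose s)) * ?D s f * ?D (Suc n - s) g)"
    by (subst sum.atMost_Suc_shift) simp
  finally show ?case by (simp only: binomial_gbinomial)
qed simp

text \<open>
  The convolution identity of Vandermonde, after \<open>binom(x, q) binom(q, s)\<close> is rewritten as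
  \<open>binom(x, s) binom(x - s, q - s)\<close>. It is the comparison of the coefficients of
  \<open>a b\<^bsup>(s)\<^esup> c\<^bsup>(D - s)\<^esup>\<close> in the two bracketings of a product of three monomials.
\<close>

lemma gbinomial_composition:
  fixes x y :: "'a::field_char_0"
  assumes "s \<le> D"
  shows "(\<Sum>q=s..D. (x gchoose q) * (y gchoose (D - q)) * (of_nat q gchoose s)) =
    (x gchoose s) * (x + y - of_nat s gchoose (D - s))"
proof -
  have "(\<Sum>q=s..D. (x gchoose q) * (y gchoose (D - q)) * (of_nat q gchoose s)) =
    (\<Sum>q=s..D. (x gchoose s) * ((x - of_nat s gchoose (q - s)) * (y gchoose (D - q))))"
    by (intro sum.cong refl) (use gbinomial_trinomial_revision in \<open>fastforce simp: algebra_simps\<close>)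
  also have "\<dots> = (x gchoose s) *
      (\<Sum>u=0..D - s. (x - of_nat s gchoose u) * (y gchoose (D - s - u)))"
    unfolding sum_distrib_left
    by (rule sum.reindex_bij_witness[where i = "\<lambda>u. u + s" and j = "\<lambda>q. q - s"])
       (use assms in auto)
  finally show ?thesis unfolding gbinomial_Vandermonde by (simp add: algebra_simps)
qed

lemma mon_mult_assoc:
  fixes a b c :: "'k::field_char_0 fls"
  shows "(pdo_mon a i * pdo_mon b j) * pdo_mon c k = pdo_mon a i * (pdo_mon b j * pdo_mon c k)"
proof (rule pdo_eqI)
  fix n
  let ?d = "\<lambda>l. fls_deriv ^^ l"
  have ab: "pdo_ord_le (pdo_mon a i * pdo_mon b j) (i + j)"
    by (intro ord_le_mult ord_le_mon) auto
  have bc: "pdo_ord_le (pdo_mon b j * pdo_mon c k) (j + k)"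
    by (intro ord_le_mult ord_le_mon) auto
  show "pdo_coeff ((pdo_mon a i * pdo_mon b j) * pdo_mon c k) n =
      pdo_coeff (pdo_mon a i * (pdo_mon b j * pdo_mon c k)) n"
  proof (cases "n \<le> i + j + k")
    case False
    then show ?thesis
      using ord_leD[OF ord_le_mult[OF ab ord_le_mon[of k k c] order_refl]]
        ord_leD[OF ord_le_mult[OF ord_le_mon[of i i a] bc order_refl]] by simp
  next
    case True
    define D where "D = nat (i + j + k - n)"
    have n: "n = i + j + k - int D" using True by (simp add: D_def)
    let ?x = "of_int i :: 'k" and ?y = "of_int j :: 'k"
    \<comment> \<open>On the left the power \<open>p\<close> of the derivation falls on \<open>c\<close> and the rest on \<open>b\<close>.\<close>
    have "pdo_coeff ((pdo_mon a i * pdo_mon b j) * pdo_mon c k) n =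
      (\<Sum>p\<le>D. fls_const (of_int (n - k + int p) gchoose p)
        * pdo_coeff (pdo_mon a i * pdo_mon b j) (n - k + int p) * ?d p c)"
      by (rule coeff_mult_mon) (use ab in \<open>simp add: n\<close>)
    also have "\<dots> = (\<Sum>p\<le>D. fls_const ((?x gchoose (D - p)) *
        (?x + ?y - of_nat (D - p) gchoose p)) * a * ?d (D - p) b * ?d p c)"
      by (intro sum.cong refl)
         (simp add: coeff_mon_mult_mon n nat_diff_distrib algebra_simps of_nat_diff
           flip: fls_const_mult_const)
    also have "\<dots> = (\<Sum>s\<le>D. fls_const ((?x gchoose s) *
        (?x + ?y - of_nat s gchoose (D - s))) * a * ?d s b * ?d (D - s) c)"
      by (rule sum.reindex_bij_witness[where i = "\<lambda>s. D - s" and j = "\<lambda>s. D - s"]) auto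
    also have "\<dots> = (\<Sum>s\<le>D. \<Sum>q=s..D. fls_const ((?x gchoose q) * (?y gchoose (D - q))
        * (of_nat q gchoose s)) * a * ?d s b * ?d (D - s) c)"
    proof (rule sum.cong)
      fix s assume "s \<in> {..D}"
      have sc: "(\<Sum>q\<in>Q. fls_const (g q)) = fls_const (\<Sum>q\<in>Q. g q)" for Q :: "nat set" and g :: "nat \<Rightarrow> 'k"
        by (induction Q rule: infinite_finite_induct) (simp_all add: fls_plus_const)
      show "fls_const ((?x gchoose s) * (?x + ?y - of_nat s gchoose (D - s))) * a * ?d s b * ?d (D - s) c =
        (\<Sum>q=s..D. fls_const ((?x gchoose q) * (?y gchoose (D - q))
        * (of_nat q gchoose s)) * a * ?d s b * ?d (D - s) c)"
        using gbinomial_composition[of s D ?x ?y] \<open>s \<in> {..D}\<close>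
        by (simp add: sc flip: sum_distrib_right del: fls_const_mult_const)
    qed simp
    also have "\<dots> = (\<Sum>q\<le>D. \<Sum>s\<le>q. fls_const ((?x gchoose q) * (?y gchoose (D - q))
        * (of_nat q gchoose s)) * a * ?d s b * ?d (D - s) c)"
      unfolding sum.Sigma[OF finite_atMost ballI[OF finite_atLeastAtMost]]
        sum.Sigma[OF finite_atMost ballI[OF finite_atMost]]
      by (rule sum.reindex_bij_witness[where i = "\<lambda>(q, s). (s, q)" and j = "\<lambda>(s, q). (q, s)"]) auto
    \<comment> \<open>The right bracketing, in which the Leibniz rule distributes \<open>d\<^sup>q\<close> over \<open>b\<close> and \<open>d\<^bsup>D-q\<^esup> c\<close>.\<close>
    also have "\<dots> = (\<Sum>q\<le>D. fls_const (?x gchoose q) * a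
        * ?d q (fls_const (?y gchoose (D - q)) * b * ?d (D - q) c))"
    proof (intro sum.cong refl)
      fix q assume "q \<in> {..D}"
      have dc: "?d q (fls_const u * f) = fls_const u * ?d q f" for u and f :: "'k fls"
        by (induction q) (simp_all add: fls_deriv_mult_const_left)
      have dd: "?d (q - s) (?d (D - q) c) = ?d (D - s) c" if "s \<le> q" for s
        using that \<open>q \<in> {..D}\<close> by (simp flip: funpow_add[THEN fun_cong, unfolded comp_def])
      show "(\<Sum>s\<le>q. fls_const ((?x gchoose q) * (?y gchoose (D - q))
        * (of_nat q gchoose s)) * a * ?d s b * ?d (D - s) c) = fls_const (?x gchoose q) * a
        * ?d q (fls_const (?y gchoose (D - q)) * b * ?d (D - q) c)"
        unfolding mult.assoc dc
        unfolding fls_deriv_iter_mult[of q b] sum_distrib_left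
        by (intro sum.cong refl) (simp add: dd algebra_simps flip: fls_const_mult_const)
    qed
    also have "\<dots> = (\<Sum>q\<le>D. fls_const (?x gchoose q) * a
        * ?d q (pdo_coeff (pdo_mon b j * pdo_mon c k) (n - i + int q)))"
      by (intro sum.cong refl) (simp add: coeff_mon_mult_mon n nat_diff_distrib)
    also have "\<dots> = pdo_coeff (pdo_mon a i * (pdo_mon b j * pdo_mon c k)) n"
      by (rule coeff_mon_mult[symmetric]) (use bc in \<open>simp add: n\<close>)
    finally show ?thesis .
  qed
qed

text \<open>
  The associator is additive in each argument, and its coefficient at \<open>\<partial>\<^sup>n\<close> vanishes once the sum of
  the three orders is below \<open>n\<close>. Hence the arguments can be replaced by monomials one at a time;
  \<open>C\<close> comes first because the other two orders are then known.
\<close>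

lemma pdo_mult_assoc: "(A * B) * C = A * (B * C :: 'k::field_char_0 pdo)"
proof -
  obtain NA NB NC where N: "pdo_ord_le A NA" "pdo_ord_le B NB" "pdo_ord_le C NC"
    using ex_ord_le by metis
  define f where "f n A B C = pdo_coeff ((A * B) * C) n - pdo_coeff (A * (B * C)) n"
    for n and A B C :: "'k pdo"
  have add: "f n (A + A') B C = f n A B C + f n A' B C"
    "f n A (B + B') C = f n A B C + f n A B' C"
    "f n A B (C + C') = f n A B C + f n A B C'" for n A A' B B' C C'
    by (simp_all add: f_def pdo_distrib_left pdo_distrib_right)
  have low: "f n A B C = 0"
    if "pdo_ord_le A u" "pdo_ord_le B v" "pdo_ord_le C w" "u + v + w < n" for n A B C u v w
  proof -
    have "pdo_ord_le ((A * B) * C) (u + v + w)" "pdo_ord_le (A * (B * C)) (u + v + w)"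
      using ord_le_mult[OF ord_le_mult[OF that(1,2) order_refl] that(3)]
        ord_le_mult[OF that(1) ord_le_mult[OF that(2,3) order_refl]] by (simp_all add: add.assoc)
    then show ?thesis using that(4) by (simp add: f_def ord_leD)
  qed
  have 1: "f n (pdo_mon a i) (pdo_mon b j) C = 0" for n a i b j C
  proof (rule additive_eq_zero[where f = "\<lambda>C. f n (pdo_mon a i) (pdo_mon b j) C"])
    show "\<exists>e. \<forall>C. pdo_ord_le C e \<longrightarrow> f n (pdo_mon a i) (pdo_mon b j) C = 0"
      by (rule exI[of _ "n - i - j - 1"])
         (use low[OF ord_le_mon[of i i] ord_le_mon[of j j]] in force)
  qed (rule add(3), simp add: f_def mon_mult_assoc)
  have 2: "f n (pdo_mon a i) B C = 0" if "pdo_ord_le C w" for n a i B C w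
  proof (rule additive_eq_zero[where f = "\<lambda>B. f n (pdo_mon a i) B C"])
    show "\<exists>e. \<forall>B. pdo_ord_le B e \<longrightarrow> f n (pdo_mon a i) B C = 0"
      by (rule exI[of _ "n - i - w - 1"]) (use low[OF ord_le_mon[of i i] _ that] in force)
  qed (simp_all add: add 1)
  have 3: "f n A B C = 0" if "pdo_ord_le B v" "pdo_ord_le C w" for n A B C v w
  proof (rule additive_eq_zero[where f = "\<lambda>A. f n A B C"])
    show "\<exists>e. \<forall>A. pdo_ord_le A e \<longrightarrow> f n A B C = 0"
      by (rule exI[of _ "n - v - w - 1"]) (use low[OF _ that] in force)
  qed (use that 2 in \<open>auto simp: add\<close>)
  show ?thesis
    by (rule pdo_eqI) (use 3[OF N(2,3), of _ A] in \<open>simp add: f_def\<close>)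
qed

lemma one_eq_mon: "1 = pdo_mon 1 0"
  by (rule pdo_eqI) (simp add: coeff_one coeff_mon)

lemma del_eq_mon: "pdo_del m = pdo_mon 1 m"
  by (rule pdo_eqI) (simp add: coeff_del coeff_mon)

instance pdo :: (field_char_0) ring_1
proof
  fix A B C :: "'a pdo"
  show "A * B * C = A * (B * C)" by (rule pdo_mult_assoc)
  show "(A + B) * C = A * C + B * C" by (rule pdo_distrib_right)
  show "A * (B + C) = A * B + A * C" by (rule pdo_distrib_left)
  show "(0 :: 'a pdo) \<noteq> 1"
    by (metis coeff_one coeff_zero zero_neq_one)
  obtain N where N: "pdo_ord_le A N" using ex_ord_le by blast
  show "1 * A = A"
  proof (rule pdo_eqI)
    fix n
    have "pdo_coeff (pdo_mon 1 0 * A) n = (\<Sum>l\<le>nat (N - n).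
        fls_const ((0::'a) gchoose l) * 1 * (fls_deriv ^^ l) (pdo_coeff A (n + int l)))"
      using coeff_mon_mult[of A n 0 "nat (N - n)" 1] ord_le_mono[OF N] by simp
    also have "\<dots> = (\<Sum>l\<in>{0}.
        fls_const ((0::'a) gchoose l) * 1 * (fls_deriv ^^ l) (pdo_coeff A (n + int l)))"
      by (rule sum.mono_neutral_right) (auto simp: gbinomial_0_left)
    finally show "pdo_coeff (1 * A) n = pdo_coeff A n" by (simp add: one_eq_mon)
  qed
  show "A * 1 = A"
  proof (rule pdo_eqI)
    fix n
    have "pdo_coeff (A * pdo_mon 1 0) n = (\<Sum>l\<le>nat (N - n).
        fls_const (of_int (n + int l) gchoose l) * pdo_coeff A (n + int l) * (fls_deriv ^^ l) 1)"
      using coeff_mult_mon[of A n 0 "nat (N - n)" 1] ord_le_mono[OF N] by simp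
    also have "\<dots> = (\<Sum>l\<in>{0}.
        fls_const (of_int (n + int l) gchoose l) * pdo_coeff A (n + int l) * (fls_deriv ^^ l) 1)"
      by (rule sum.mono_neutral_right) (auto simp: gr0_conv_Suc funpow_swap1)
    finally show "pdo_coeff (A * 1) n = pdo_coeff A n" by (simp add: one_eq_mon)
  qed
qed

section \<open>The residue is a trace\<close>

lemma fls_residue_parts:
  "fls_residue (f * (fls_deriv ^^ l) g) =
    (- 1) ^ l * fls_residue ((fls_deriv ^^ l) f * g :: 'k::field_char_0 fls)"
proof (induction l arbitrary: g)
  case (Suc l)
  have "fls_residue (f * (fls_deriv ^^ Suc l) g) = fls_residue (f * (fls_deriv ^^ l) (fls_deriv g))"
    by (simp add: funpow_swap1)
  also have "\<dots> = (- 1) ^ l * fls_residue ((fls_deriv ^^ l) f * fls_deriv g)"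
    by (rule Suc.IH)
  also have "\<dots> = (- 1) ^ Suc l * fls_residue ((fls_deriv ^^ Suc l) f * g)"
    using fls_residue_times_deriv[of "(fls_deriv ^^ l) f" g] by simp
  finally show ?case .
qed simp

lemma pdo_res_add: "pdo_res (A + B) = pdo_res A + pdo_res B"
  by (simp add: pdo_res_def)

text \<open>
  With \<open>l = i + j + 1\<close> the two residues are \<open>binom(i, l) Res(a b\<^bsup>(l)\<^esup>)\<close> and \<open>binom(j, l) Res(b a\<^bsup>(l)\<^esup>)\<close>.
  Integration by parts contributes the sign \<open>(-1)\<^sup>l\<close>, and so does the upper negation
  \<open>binom(i, l) = (-1)\<^sup>l binom(l - i - 1, l) = (-1)\<^sup>l binom(j, l)\<close>.
\<close>

lemma pdo_res_mon_commute:
  "pdo_res (pdo_mon a i * pdo_mon b j) = pdo_res (pdo_mon b j * pdo_mon a i)"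
proof (cases "- 1 \<le> i + j")
  case True
  define l where "l = nat (i + j + 1)"
  have j: "of_nat l - of_int i - 1 = (of_int j :: 'a)"
    using True by (simp add: l_def)
  have res: "fls_residue (fls_const u * f * g) = u * fls_residue (f * g)"
    for u and f g :: "'a fls"
    by (metis fls_residue_fls_const_times(1) mult.assoc)
  have "pdo_res (pdo_mon a i * pdo_mon b j) =
      (of_int i gchoose l) * fls_residue (a * (fls_deriv ^^ l) b)"
    using True unfolding pdo_res_def
    by (simp only: coeff_mon_mult_mon if_True res diff_minus_eq_add flip: l_def)
  also have "\<dots> = (of_int j gchoose l) * fls_residue (b * (fls_deriv ^^ l) a)"
    unfolding fls_residue_parts[of a] gbinomial_negated_upper[of "of_int i"] j
    by (simp add: mult.commute flip: power_mult_distrib)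
  also have "\<dots> = pdo_res (pdo_mon b j * pdo_mon a i)"
    using True unfolding pdo_res_def
    by (simp only: coeff_mon_mult_mon if_True res diff_minus_eq_add add.commute[of j] flip: l_def)
  finally show ?thesis .
next
  case False
  then show ?thesis by (simp add: pdo_res_def coeff_mon_mult_mon)
qed

lemma pdo_res_commute: "pdo_res (A * B) = pdo_res (B * A)"
proof -
  define f where "f A B = pdo_res (A * B) - pdo_res (B * A)" for A B :: "'a pdo"
  have add: "f (A + A') B = f A B + f A' B" "f A (B + B') = f A B + f A B'" for A A' B B'
    by (simp_all add: f_def distrib_left distrib_right pdo_res_add)
  have low: "f A B = 0" if "pdo_ord_le A u" "pdo_ord_le B v" "u + v < -1" for A B u v
  proof -
    have "pdo_ord_le (A * B) (u + v)" "pdo_ord_le (B * A) (u + v)"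
      using that by (auto intro: ord_le_mult)
    then show ?thesis using that(3) by (simp add: f_def pdo_res_def ord_leD)
  qed
  have 1: "f (pdo_mon a i) B = 0" for a i B
  proof (rule additive_eq_zero[where f = "f (pdo_mon a i)"])
    show "\<exists>e. \<forall>B. pdo_ord_le B e \<longrightarrow> f (pdo_mon a i) B = 0"
      by (rule exI[of _ "- i - 2"]) (use low[OF ord_le_mon[of i i]] in force)
    show "f (pdo_mon a i) (pdo_mon b j) = 0" for b j
      by (simp add: f_def pdo_res_mon_commute[of a])
  qed (rule add)
  obtain v where v: "pdo_ord_le B v" using ex_ord_le by blast
  have "f A B = 0"
  proof (rule additive_eq_zero[where f = "\<lambda>A. f A B"])
    show "\<exists>e. \<forall>A. pdo_ord_le A e \<longrightarrow> f A B = 0"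
      by (rule exI[of _ "- v - 2"]) (use low[OF _ v] in force)
  qed (simp_all add: add 1)
  then show ?thesis by (simp add: f_def)
qed

section \<open>Completeness and inverses\<close>

text \<open>
  Completeness: the coefficient at \<open>\<partial>\<^sup>i\<close> is constant in \<open>X m\<close> from \<open>m = e - i + 1\<close> on, and these
  eventual values form the limit. Inverses, roots and conjugating operators are all constructed
  as such limits, one coefficient at a time.
\<close>

lemma ord_le_limit:
  fixes X :: "nat \<Rightarrow> 'k::field_char_0 pdo"
  assumes step: "\<And>m. pdo_ord_le (X (Suc m) - X m) (e - int m)"
  obtains Y where "\<And>m. pdo_ord_le (Y - X m) (e - int m)"
proof -
  have Cauchy: "pdo_ord_le (X (t + d) - X t) (e - int t)" for t d
  proof (induction d)
    case (Suc d)
    have "pdo_ord_le (X (Suc (t + d)) - X (t + d)) (e - int t)"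
      by (rule ord_le_mono[OF step]) simp
    from ord_le_add[OF this Suc.IH] show ?case by simp
  qed simp
  define t where "t i = nat (e - i + 1)" for i
  define y where "y i = pdo_coeff (X (t i)) i" for i
  obtain N where N: "pdo_ord_le (X 0) N" using ex_ord_le by blast
  have "\<forall>i>max N e. y i = 0"
    using ord_leD[OF N] by (simp add: y_def t_def)
  then have Y: "pdo_coeff (Abs_pdo y) = y"
    by (intro Abs_pdo_inverse) blast
  have "pdo_ord_le (Abs_pdo y - X m) (e - int m)" for m
    unfolding pdo_ord_le_def
  proof (intro allI impI)
    fix i assume "e - int m < i"
    then have m: "m = t i + (m - t i)" and i: "e - int (t i) < i" by (auto simp: t_def)
    have "pdo_coeff (X m - X (t i)) i = 0"
      using ord_leD[OF Cauchy[of "t i" "m - t i"] i] m by simp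
    then show "pdo_coeff (Abs_pdo y - X m) i = 0" by (simp add: Y y_def)
  qed
  then show thesis by (rule that)
qed

lemma ord_le_power: "pdo_ord_le A n \<Longrightarrow> pdo_ord_le (A ^ m) (int m * n)"
proof (induction m)
  case (Suc m)
  then show ?case by (auto intro!: ord_le_mult[of _ n _ "int m * n"] simp: algebra_simps)
qed (simp add: ord_le_one)

text \<open>
  The geometric series. Its partial sums commute with \<open>R\<close>, which makes the limit an inverse on both
  sides.
\<close>

lemma ex_inverse_one_minus:
  assumes R: "pdo_ord_le R (- 1)"
  shows "\<exists>Y. (1 - R) * Y = 1 \<and> Y * (1 - R) = 1"
proof -
  define X where "X m = (\<Sum>i<m. R ^ i)" for m
  have pow: "pdo_ord_le (R ^ m) (0 - int m)" for m
    using ord_le_power[OF R, of m] by simp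
  have "pdo_ord_le (X (Suc m) - X m) (0 - int m)" for m
    using pow by (simp add: X_def)
  from ord_le_limit[OF this] obtain Y where Y: "\<And>m. pdo_ord_le (Y - X m) (0 - int m)"
    by blast
  have XR: "X m * R = R * X m" for m
    by (simp add: X_def sum_distrib_left sum_distrib_right power_commutes)
  have geo: "(1 - R) * X m = 1 - R ^ m" for m
    by (induction m) (simp_all add: X_def distrib_left, simp add: left_diff_distrib)
  have R1: "pdo_ord_le (1 - R) 0"
    by (intro ord_le_diff ord_le_one ord_le_mono[OF R]) auto
  have "(1 - R) * Y - 1 = 0"
  proof (rule zero_if_ord_le_all[where e = 0])
    fix m
    have "(1 - R) * Y - 1 = (1 - R) * (Y - X m) - R ^ m"
      by (simp add: geo right_diff_distrib)
    then show "pdo_ord_le ((1 - R) * Y - 1) (0 - int m)"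
      using ord_le_diff[OF ord_le_mult[OF R1 Y] pow] by simp
  qed
  moreover have "Y * (1 - R) - 1 = 0"
  proof (rule zero_if_ord_le_all[where e = 0])
    fix m
    have "X m * (1 - R) = 1 - R ^ m"
      using geo[of m] XR[of m] by (simp add: left_diff_distrib right_diff_distrib)
    then have "Y * (1 - R) - 1 = (Y - X m) * (1 - R) - R ^ m"
      by (simp add: left_diff_distrib)
    then show "pdo_ord_le (Y * (1 - R) - 1) (0 - int m)"
      using ord_le_diff[OF ord_le_mult[OF Y R1] pow] by simp
  qed
  ultimately show ?thesis by auto
qed

lemma mon_mult_del: "pdo_mon a i * pdo_mon 1 j = pdo_mon a (i + j)"
proof (rule pdo_eqI)
  fix n
  have "(fls_deriv ^^ nat (i + j - n)) (1 :: 'a fls) = 0" if "n < i + j"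
    using that by (cases "nat (i + j - n)") (auto simp: funpow_swap1)
  then show "pdo_coeff (pdo_mon a i * pdo_mon 1 j) n = pdo_coeff (pdo_mon a (i + j)) n"
    by (auto simp: coeff_mon_mult_mon coeff_mon)
qed

lemma mon_0_mult: "pdo_mon a 0 * pdo_mon b j = pdo_mon (a * b) j"
proof (rule pdo_eqI)
  fix n
  have "((0 :: 'a) gchoose nat (j - n)) = 0" if "n < j"
    using that by (simp add: gbinomial_0_left)
  then show "pdo_coeff (pdo_mon a 0 * pdo_mon b j) n = pdo_coeff (pdo_mon (a * b) j) n"
    by (auto simp: coeff_mon_mult_mon coeff_mon)
qed

lemma ex_leading:
  fixes A :: "'k::field_char_0 pdo"
  assumes "A \<noteq> 0"
  obtains m where "pdo_ord_le A m" and "pdo_coeff A m \<noteq> 0"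
proof -
  obtain N where N: "pdo_ord_le A N" using ex_ord_le by blast
  obtain i where i: "pdo_coeff A i \<noteq> 0" using assms pdo_eqI[of A 0] by auto
  have "\<exists>m. pdo_ord_le A m \<and> pdo_coeff A m \<noteq> 0" if "pdo_ord_le A (i + int d)" for d
    using that
  proof (induction d)
    case 0
    with i show ?case by auto
  next
    case (Suc d)
    then show ?case using ord_le_lower[OF Suc.prems] by (auto simp: algebra_simps)
  qed
  moreover have "pdo_ord_le A (i + int (nat (N - i)))" by (rule ord_le_mono[OF N]) simp
  ultimately show thesis using that by blast
qed

text \<open>
  The leading term \<open>U = a\<partial>\<^sup>m\<close> has the inverse \<open>V = \<partial>\<^bsup>-m\<^esup>a\<^sup>-\<^sup>1\<close>, and \<open>VA\<close> differs from 1 by an operator of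
  negative order, so that the geometric series applies.
\<close>

lemma ex_inverse:
  fixes A :: "'k::field_char_0 pdo"
  assumes "A \<noteq> 0"
  shows "\<exists>B. A * B = 1 \<and> B * A = 1"
proof -
  obtain m where m: "pdo_ord_le A m" and a: "pdo_coeff A m \<noteq> 0"
    using ex_leading[OF assms] .
  let ?a = "pdo_coeff A m"
  define U where "U = pdo_mon ?a m"
  define V where "V = pdo_mon 1 (- m) * pdo_mon (inverse ?a) 0"
  have U: "U = pdo_mon ?a 0 * pdo_mon 1 m" by (simp add: U_def mon_0_mult)
  have i: "pdo_mon x 0 * pdo_mon y 0 = 1" if "x * y = 1" for x y :: "'k fls"
    using that by (simp add: mon_0_mult one_eq_mon)
  have d: "pdo_mon 1 x * pdo_mon 1 (- x) = (1 :: 'k pdo)" for x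
    by (simp add: mon_mult_del one_eq_mon)
  have UV: "U * V = 1"
  proof -
    have "U * V = pdo_mon ?a 0 * (pdo_mon 1 m * pdo_mon 1 (- m)) * pdo_mon (inverse ?a) 0"
      by (simp only: U V_def mult.assoc)
    then show ?thesis using a by (simp add: d i)
  qed
  have VU: "V * U = 1"
  proof -
    have "V * U = pdo_mon 1 (- m) * (pdo_mon (inverse ?a) 0 * pdo_mon ?a 0) * pdo_mon 1 m"
      by (simp only: U V_def mult.assoc)
    then show ?thesis using a d[of "- m"] by (simp add: i)
  qed
  define R where "R = V * (U - A)"
  have "pdo_ord_le (U - A) (m - 1)"
    using m by (intro ord_le_lower ord_le_diff) (auto simp: U_def coeff_mon ord_le_mon)
  moreover have "pdo_ord_le V (- m)"
    unfolding V_def by (intro ord_le_mult[of _ "- m" _ 0] ord_le_mon) auto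
  ultimately have "pdo_ord_le R (- 1)"
    unfolding R_def by (intro ord_le_mult[of V "- m" _ "m - 1"]) auto
  then obtain Y where Y: "(1 - R) * Y = 1" "Y * (1 - R) = 1"
    using ex_inverse_one_minus by blast
  have VA: "V * A = 1 - R" by (simp add: R_def right_diff_distrib VU)
  then have A: "A = U * (1 - R)" by (metis UV mult.assoc mult_1_left)
  have "A * (Y * V) = 1" by (metis A UV Y(1) mult.assoc mult_1_right)
  moreover have "(Y * V) * A = 1" by (simp add: mult.assoc VA Y(2))
  ultimately show ?thesis by blast
qed

instance pdo :: (field_char_0) division_ring
proof
  fix A B :: "'a pdo"
  have inv: "A * inverse A = 1 \<and> inverse A * A = 1" if "A \<noteq> 0"
  proof -
    have ex: "\<exists>B. A * B = 1 \<and> B * A = 1" using ex_inverse[OF that] .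
    then obtain B where B: "A * B = 1" "B * A = 1" by blast
    have "\<exists>!B. A * B = 1 \<and> B * A = 1"
    proof (rule ex1I[of _ B])
      fix C assume C: "A * C = 1 \<and> C * A = 1"
      have "C = C * (A * B)" by (simp add: B)
      also have "\<dots> = B" using C by (simp flip: mult.assoc)
      finally show "C = B" .
    qed (use B in simp)
    from theI'[OF this] ex show ?thesis by (simp add: inverse_pdo_def)
  qed
  then show "A \<noteq> 0 \<Longrightarrow> inverse A * A = 1" "A \<noteq> 0 \<Longrightarrow> A * inverse A = 1" by auto
  show "A / B = A * inverse B" by (rule divide_pdo_def)
  show "inverse (0 :: 'a pdo) = 0" by (simp add: inverse_pdo_def)
qed

section \<open>Monic operators and their roots\<close>

definition pdo_monic :: "'k::field_char_0 pdo \<Rightarrow> int \<Rightarrow> bool" where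
  "pdo_monic A m \<longleftrightarrow> pdo_ord_le A m \<and> pdo_coeff A m = 1"

lemma pdo_monicD: "pdo_monic A m \<Longrightarrow> pdo_ord_le A m" "pdo_monic A m \<Longrightarrow> pdo_coeff A m = 1"
  by (simp_all add: pdo_monic_def)

lemma monic_nonzero: "pdo_monic A m \<Longrightarrow> A \<noteq> 0"
  by (auto simp: pdo_monic_def)

lemma monic_one: "pdo_monic 1 0"
  by (simp add: pdo_monic_def ord_le_one coeff_one)

lemma monic_del: "pdo_monic (pdo_mon 1 m) m"
  by (simp add: pdo_monic_def ord_le_mon coeff_mon)

lemma monic_mult: "pdo_monic A m \<Longrightarrow> pdo_monic B n \<Longrightarrow> pdo_monic (A * B) (m + n)"
  unfolding pdo_monic_def using ord_le_mult[of A m B n, OF _ _ order_refl]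
  by (simp add: coeff_mult_top)

lemma monic_if_lower: "pdo_monic A m \<Longrightarrow> pdo_ord_le (B - A) (m - 1) \<Longrightarrow> pdo_monic B m"
  using ord_le_add[of A m "B - A", OF _ ord_le_mono[of "B - A" "m - 1" m]]
    ord_leD[of "B - A" "m - 1" m]
  by (auto simp: pdo_monic_def)

lemma monic_diff: "pdo_monic A m \<Longrightarrow> pdo_monic B m \<Longrightarrow> pdo_ord_le (A - B) (m - 1)"
  by (intro ord_le_lower ord_le_diff) (auto simp: pdo_monic_def)

lemma monic_inverse:
  assumes "pdo_monic A m"
  shows "pdo_monic (inverse A) (- m)"
proof -
  note A = pdo_monicD[OF assms] and nz = monic_nonzero[OF assms]
  from nz obtain k where k: "pdo_ord_le (inverse A) k" "pdo_coeff (inverse A) k \<noteq> 0"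
    using ex_leading[of "inverse A"] by auto
  \<comment> \<open>The leading coefficient of the inverse is a nonzero coefficient of 1.\<close>
  have "pdo_coeff (A * inverse A) (m + k) = pdo_coeff (inverse A) k"
    by (simp only: coeff_mult_top[OF A(1) k(1)] A(2) mult_1_left)
  then have "(if m + k = 0 then 1 else 0) = pdo_coeff (inverse A) k"
    using nz by (simp add: coeff_one)
  with k(2) have "k = - m" "pdo_coeff (inverse A) k = 1" by (auto split: if_splits)
  with k(1) show ?thesis by (simp add: pdo_monic_def)
qed

lemma monic_power: "pdo_monic A m \<Longrightarrow> pdo_monic (A ^ n) (int n * m)"
proof (induction n)
  case (Suc n)
  then show ?case using monic_mult[of A m "A ^ n" "int n * m"] by (simp add: algebra_simps)
qed (simp add: monic_one)

lemma pdo_ord_eqI: "pdo_ord_le A m \<Longrightarrow> pdo_coeff A m \<noteq> 0 \<Longrightarrow> pdo_ord A = m"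
  unfolding pdo_ord_def by (rule Greatest_equality) (auto simp: pdo_ord_le_def not_less[symmetric])

lemma monic_ord: "pdo_monic A m \<Longrightarrow> pdo_ord A = m"
  by (rule pdo_ord_eqI) (auto simp: pdo_monic_def)

lemma ord_less_iff: "pdo_ord_less A n \<longleftrightarrow> pdo_ord_le A (n - 1)"
proof (cases "A = 0")
  case False
  then obtain m where m: "pdo_ord_le A m" "pdo_coeff A m \<noteq> 0" using ex_leading by blast
  have "pdo_ord_le A (n - 1) \<longleftrightarrow> m < n"
    using m ord_leD[of A "n - 1" m] ord_le_mono[of A m "n - 1"] by force
  then show ?thesis using False pdo_ord_eqI[OF m] by (simp add: pdo_ord_less_def)
qed (simp add: pdo_ord_less_def)

lemma highest_del_iff: "pdo_highest_del A m \<longleftrightarrow> pdo_monic A m"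
proof
  assume "pdo_highest_del A m"
  then obtain R where "pdo_ord_le R (m - 1)" "A = pdo_mon 1 m + R"
    by (auto simp: pdo_highest_del_def ord_less_iff del_eq_mon)
  then show "pdo_monic A m" using monic_if_lower[OF monic_del[of m], of A] by simp
next
  assume "pdo_monic A m"
  then have "pdo_ord_less (A - pdo_del m) m"
    using monic_diff[OF _ monic_del] by (simp add: ord_less_iff del_eq_mon)
  then show "pdo_highest_del A m"
    unfolding pdo_highest_del_def by (intro exI[of _ "A - pdo_del m"]) simp
qed

text \<open>
  The derivative of \<open>N \<mapsto> N\<^sup>m\<close> to first order: changing the coefficient at \<open>\<partial>\<^sup>e\<close> by \<open>c\<close> changes the
  power by \<open>m c \<partial>\<^bsup>e+m-1\<^esup>\<close> plus lower terms, because leading coefficients commute. In characteristic 0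
  this makes roots unique, lets them be constructed coefficient by coefficient, and for
  \<open>e = - m\<close> relates the first difference of two operators to the residue of their \<open>m\<close>-th powers.
\<close>

lemma monic_power_diff:
  assumes N: "pdo_monic N 1" and N': "pdo_monic N' 1" and e: "pdo_ord_le (N - N') e"
  shows "pdo_ord_le (N ^ m - N' ^ m) (e + int m - 1) \<and>
    pdo_coeff (N ^ m - N' ^ m) (e + int m - 1) = of_nat m * pdo_coeff (N - N') e"
proof (induction m)
  case (Suc m)
  have eq: "N ^ Suc m - N' ^ Suc m = N ^ m * (N - N') + (N ^ m - N' ^ m) * N'"
    by (simp add: power_Suc2 algebra_simps del: power_Suc)
  have Nm: "pdo_monic (N ^ m) (int m)" using monic_power[OF N, of m] by simp
  note IH = conjunct1[OF Suc.IH] conjunct2[OF Suc.IH]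
  have k: "e + int (Suc m) - 1 = int m + e" "e + int (Suc m) - 1 = (e + int m - 1) + 1"
    by simp_all
  have "pdo_coeff (N ^ m * (N - N')) (e + int (Suc m) - 1) = pdo_coeff (N - N') e"
    unfolding k(1) coeff_mult_top[OF pdo_monicD(1)[OF Nm] e] by (simp add: pdo_monicD[OF Nm])
  moreover have "pdo_coeff ((N ^ m - N' ^ m) * N') (e + int (Suc m) - 1) =
      of_nat m * pdo_coeff (N - N') e"
    unfolding k(2) coeff_mult_top[OF IH(1) pdo_monicD(1)[OF N']]
    by (simp only: pdo_monicD[OF N'] IH(2) mult_1_right)
  moreover have "pdo_ord_le (N ^ m * (N - N')) (e + int (Suc m) - 1)"
    by (rule ord_le_mult[OF pdo_monicD(1)[OF Nm] e]) simp
  moreover have "pdo_ord_le ((N ^ m - N' ^ m) * N') (e + int (Suc m) - 1)"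
    by (rule ord_le_mult[OF IH(1) pdo_monicD(1)[OF N']]) simp
  ultimately show ?case unfolding eq coeff_add by (intro conjI ord_le_add) (simp_all add: distrib_right)
qed simp

lemma fls_of_nat_nonzero: "0 < m \<Longrightarrow> (of_nat m :: 'k::field_char_0 fls) \<noteq> 0"
  by (simp add: fls_of_nat)

lemma monic_root_unique:
  assumes N: "pdo_monic N 1" and N': "pdo_monic N' 1" and "N ^ m = N' ^ m" and "0 < m"
  shows "N = N'"
proof -
  have "pdo_ord_le (N - N') (0 - int t)" for t
  proof (induction t)
    case 0
    show ?case using monic_diff[OF N N'] by simp
  next
    case (Suc t)
    have "pdo_coeff (N - N') (0 - int t) = 0"
      using monic_power_diff[OF N N' Suc.IH, of m] assms(3,4) fls_of_nat_nonzero[of m] by auto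
    from ord_le_lower[OF Suc.IH this] show ?case by (rule ord_le_mono) simp
  qed
  from zero_if_ord_le_all[OF this] show ?thesis by simp
qed

lemma ex_monic_root:
  fixes L :: "'k::field_char_0 pdo"
  assumes L: "pdo_monic L (int r)" and r: "0 < r"
  shows "\<exists>N. pdo_monic N 1 \<and> N ^ r = L"
proof -
  let ?P = "\<lambda>m N. pdo_monic N 1 \<and> pdo_ord_le (N ^ r - L) (int r - 1 - int m)"
  have "\<exists>X. \<forall>m. ?P m (X m) \<and> pdo_ord_le (X (Suc m) - X m) (0 - int m)"
  proof (rule dependent_nat_choice)
    show "\<exists>N. ?P 0 N"
      by (rule exI[of _ "pdo_mon 1 1"])
         (use monic_diff[OF monic_power[OF monic_del[of 1], of r]] L monic_del[of 1] in auto)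
  next
    fix N :: "'k pdo" and m
    assume "?P m N"
    then have N: "pdo_monic N 1" and ord: "pdo_ord_le (N ^ r - L) (int r - 1 - int m)" by auto
    let ?k = "int r - 1 - int m"
    \<comment> \<open>Adding \<open>c\<partial>\<^bsup>-m\<^esup>\<close> changes the coefficient of the power at \<open>\<partial>\<^bsup>r-1-m\<^esup>\<close> by \<open>rc\<close>.\<close>
    let ?T = "pdo_mon (- (pdo_coeff (N ^ r - L) ?k / of_nat r)) (0 - int m)"
    have T: "pdo_ord_le (N + ?T - N) (0 - int m)" by (simp add: ord_le_mon)
    have N': "pdo_monic (N + ?T) 1"
      using monic_if_lower[OF N, of "N + ?T"] ord_le_mono[OF T, of 0] by simp
    have k: "0 - int m + int r - 1 = ?k" by simp
    note d = monic_power_diff[OF N' N T, of r, unfolded k]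
    have eq: "(N + ?T) ^ r - L = ((N + ?T) ^ r - N ^ r) + (N ^ r - L)" by simp
    have "pdo_coeff ((N + ?T) ^ r - N ^ r) ?k = - pdo_coeff (N ^ r - L) ?k"
      using conjunct2[OF d] fls_of_nat_nonzero[OF r, where 'k = 'k] by (simp add: coeff_mon)
    then have "pdo_ord_le ((N + ?T) ^ r - L) (?k - 1)"
      using conjunct1[OF d] ord unfolding eq by (intro ord_le_lower ord_le_add) simp_all
    then have "?P (Suc m) (N + ?T)" using N' by (simp add: algebra_simps)
    with T show "\<exists>N'. ?P (Suc m) N' \<and> pdo_ord_le (N' - N) (0 - int m)" by blast
  qed
  then obtain X where X: "\<And>m. ?P m (X m)"
    and step: "\<And>m. pdo_ord_le (X (Suc m) - X m) (0 - int m)" by blast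
  obtain N where N: "\<And>m. pdo_ord_le (N - X m) (0 - int m)"
    using ord_le_limit[OF step] by blast
  have mon: "pdo_monic N 1"
    using monic_if_lower[of "X 0" 1 N] X[of 0] N[of 0] by simp
  have "N ^ r - L = 0"
  proof (rule zero_if_ord_le_all)
    fix m
    have "pdo_ord_le (N ^ r - X m ^ r) (int r - 1 - int m)"
      using monic_power_diff[OF mon conjunct1[OF X[of m]] N[of m], of r] by (simp add: algebra_simps)
    from ord_le_add[OF this conjunct2[OF X]] show "pdo_ord_le (N ^ r - L) (int r - 1 - int m)"
      by simp
  qed
  with mon show ?thesis by auto
qed

text \<open>
  Roots of operators of negative order are roots of the inverses.
\<close>

lemma powi_root_iff:
  fixes N L :: "'k::field_char_0 pdo"
  assumes "r \<noteq> 0"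
  shows "N powi r = L \<longleftrightarrow> N ^ nat \<bar>r\<bar> = (if 0 < r then L else inverse L)"
proof (cases "0 < r")
  case False
  have "N powi r = inverse (N ^ nat \<bar>r\<bar>)"
    using False assms by (simp add: power_int_def power_inverse)
  with False show ?thesis by auto
qed (simp add: power_int_def)

lemma monic_root_ex1:
  fixes L :: "'k::field_char_0 pdo"
  assumes L: "pdo_monic L r" and r: "r \<noteq> 0"
  shows "\<exists>!N. pdo_monic N 1 \<and> N powi r = L"
proof -
  let ?L = "if 0 < r then L else inverse L"
  have "pdo_monic ?L (int (nat \<bar>r\<bar>))" using L monic_inverse[OF L] r by auto
  from ex_monic_root[OF this] r obtain N where "pdo_monic N 1" "N ^ nat \<bar>r\<bar> = ?L" by auto
  then show ?thesis
    unfolding powi_root_iff[OF r] using monic_root_unique[where m = "nat \<bar>r\<bar>"] r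
    by (metis zero_less_abs_iff zero_less_nat_eq)
qed

lemma pdo_root:
  assumes L: "pdo_monic L r" and r: "r \<noteq> 0"
  shows "pdo_monic (pdo_root L) 1" and "pdo_root L powi r = L"
proof -
  have "pdo_monic (pdo_root L) 1 \<and> pdo_root L powi r = L"
    unfolding pdo_root_def highest_del_iff monic_ord[OF L]
    by (rule theI'[OF monic_root_ex1[OF L r]])
  then show "pdo_monic (pdo_root L) 1" and "pdo_root L powi r = L" by auto
qed

lemma pdo_root_eqI:
  assumes "pdo_monic L r" and "r \<noteq> 0" and "pdo_monic N 1" and "N powi r = L"
  shows "pdo_root L = N"
  using monic_root_ex1[OF assms(1,2)] pdo_root[OF assms(1,2)] assms(3,4) by blast

lemma pdo_powq_eq:
  assumes "pdo_monic L r" and "r \<noteq> 0"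
  shows "pdo_powq L (of_int j / of_int r) = pdo_root L powi j"
proof -
  have "(THE i. (of_int j / of_int r :: rat) = of_int i / of_int r) = j"
    using assms(2) by (intro the_equality) auto
  then show ?thesis by (simp add: pdo_powq_def monic_ord[OF assms(1)])
qed

text \<open>
  The subleading coefficient of \<open>L\<close>, or of its inverse if \<open>r < 0\<close>, is \<open>\<bar>r\<bar>\<close> times the constant term of
  the root, by comparison of the root with \<open>\<partial>\<close>.
\<close>

lemma root_no_constant_term:
  fixes L :: "'k::field_char_0 pdo"
  assumes L: "pdo_monic L r" and r: "r \<noteq> 0" and sub: "pdo_coeff L (r - 1) = 0"
  shows "pdo_ord_le (pdo_root L - pdo_mon 1 1) (- 1)"
proof -
  let ?N = "pdo_root L" and ?n = "nat \<bar>r\<bar>"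
  have N: "pdo_monic ?N 1" "?N powi r = L" using pdo_root[OF L r] .
  have dpow: "pdo_mon 1 1 ^ m = (pdo_mon 1 (int m) :: 'k pdo)" for m
    by (induction m) (simp_all add: one_eq_mon mon_mult_del add.commute)
  have dinv: "inverse (pdo_mon 1 m) = (pdo_mon 1 (- m) :: 'k pdo)" for m
    by (rule inverse_unique) (simp add: mon_mult_del one_eq_mon)
  have low: "pdo_ord_le (L - pdo_mon 1 r) (r - 2)"
    using ord_le_lower[OF monic_diff[OF L monic_del]] sub by (simp add: coeff_mon)
  have e: "pdo_ord_le (?N - pdo_mon 1 1) 0" using monic_diff[OF N(1) monic_del] by simp
  have "pdo_ord_le (?N ^ ?n - pdo_mon 1 1 ^ ?n) (int ?n - 2)"
  proof (cases "0 < r")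
    case True
    then show ?thesis using N(2) low powi_root_iff[OF r, of ?N L] by (simp add: dpow)
  next
    case False
    have D: "pdo_mon 1 r \<noteq> (0 :: 'k pdo)" using monic_nonzero[OF monic_del] .
    have "inverse L - inverse (pdo_mon 1 r) = - (inverse L * (L - pdo_mon 1 r) * inverse (pdo_mon 1 r))"
      using D monic_nonzero[OF L] by (simp add: algebra_simps)
    moreover have "pdo_ord_le (inverse L * (L - pdo_mon 1 r) * inverse (pdo_mon 1 r)) (- r - 2)"
      unfolding dinv
      by (rule ord_le_mult[OF ord_le_mult[OF pdo_monicD(1)[OF monic_inverse[OF L]] low
              order_refl] ord_le_mon[of _ "- r"]]) auto
    ultimately show ?thesis
      using False r N(2) powi_root_iff[OF r, of ?N L] by (simp add: dpow dinv)
  qed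
  then have "pdo_coeff (?N ^ ?n - pdo_mon 1 1 ^ ?n) (0 + int ?n - 1) = 0"
    by (rule ord_leD) simp
  then have "pdo_coeff (?N - pdo_mon 1 1) 0 = 0"
    using monic_power_diff[OF N(1) monic_del e, of ?n] r fls_of_nat_nonzero[of ?n, where 'k = 'k]
    by auto
  from ord_le_lower[OF e this] show ?thesis by simp
qed

section \<open>Conjugation\<close>

lemma powi_conjugate:
  fixes S A :: "'a::division_ring"
  assumes "S \<noteq> 0"
  shows "(inverse S * A * S) powi j = inverse S * A powi j * S"
proof -
  have pow: "(inverse S * B * S) ^ n = inverse S * B ^ n * S" for B n
  proof (induction n)
    case (Suc n)
    have "inverse S * B * S * (inverse S * B ^ n * S) =
      inverse S * B * (S * inverse S) * B ^ n * S" by (simp only: mult.assoc)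
    with Suc assms show ?case by (simp add: mult.assoc)
  qed (use assms in simp)
  have inv: "inverse (inverse S * A * S) = inverse S * inverse A * S"
    using assms by (cases "A = 0") (simp_all add: nonzero_inverse_mult_distrib mult.assoc)
  show ?thesis by (simp add: power_int_def pow inv)
qed

lemma pdo_res_conjugate: "S \<noteq> 0 \<Longrightarrow> pdo_res (inverse S * A * S) = pdo_res A"
  by (subst pdo_res_commute) (simp flip: mult.assoc)

text \<open>
  Only \<open>[\<partial>, s\<partial>\<^sup>k] = s'\<partial>\<^sup>k\<close> is visible to order \<open>k\<close>. Hence correcting a conjugating operator by \<open>s\<partial>\<^sup>k\<close>
  removes an error \<open>c\<partial>\<^sup>k\<close> from \<open>NS - SN'\<close> provided that \<open>- c\<close> has an antiderivative \<open>s\<close>.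
\<close>

lemma ord_le_commutator_del_mon:
  assumes N: "pdo_ord_le (N - pdo_mon 1 1) (- 1)" and N': "pdo_ord_le (N' - pdo_mon 1 1) (- 1)"
  shows "pdo_ord_le (N * pdo_mon s k - pdo_mon s k * N' - pdo_mon (fls_deriv s) k) (k - 1)"
proof -
  let ?D = "pdo_mon 1 1" and ?T = "pdo_mon s k"
  have "?D * ?T = pdo_mon s (k + 1) + pdo_mon (fls_deriv s) k"
  proof (rule pdo_eqI)
    fix n
    consider "n > k + 1" | "n = k + 1" | "n = k" | "n < k" by linarith
    then show "pdo_coeff (?D * ?T) n = pdo_coeff (pdo_mon s (k + 1) + pdo_mon (fls_deriv s) k) n"
    proof cases
      case 4
      define l where "l = nat (1 + k - n)"
      have "(1 gchoose l) = (0 :: 'a)"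
        using 4 binomial_gbinomial[of 1 l, where 'a = 'a] by (simp add: l_def binomial_eq_0)
      with 4 show ?thesis by (simp add: coeff_mon_mult_mon coeff_mon l_def)
    qed (simp_all add: coeff_mon_mult_mon coeff_mon)
  qed
  then have "N * ?T - ?T * N' - pdo_mon (fls_deriv s) k = (N - ?D) * ?T - ?T * (N' - ?D)"
    by (simp add: left_diff_distrib right_diff_distrib mon_mult_del)
  moreover have "pdo_ord_le ((N - ?D) * ?T) (k - 1)" "pdo_ord_le (?T * (N' - ?D)) (k - 1)"
    by (auto intro: ord_le_mult[OF N ord_le_mon[of k k]] ord_le_mult[OF ord_le_mon[of k k] N'])
  ultimately show ?thesis by (simp add: ord_le_diff)
qed

text \<open>
  A limit of approximations \<open>S\<close> for which \<open>NS - SN'\<close> has order at most \<open>- 1 - m\<close>. The obstruction to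
  the next step is the residue of the coefficient \<open>c\<close> at \<open>\<partial>\<^bsup>-1-m\<^esup>\<close>. It is also the coefficient of
  \<open>S\<^sup>-\<^sup>1NS - N'\<close>, hence \<open>(m + 1)c\<close> is the coefficient at \<open>\<partial>\<^sup>-\<^sup>1\<close> of the difference of the
  \<open>(m + 1)\<close>-st powers of \<open>S\<^sup>-\<^sup>1NS\<close> and \<open>N'\<close>. The residue of that difference is 0, since the residue
  is invariant under conjugation and takes the same value at the powers of \<open>N\<close> and of \<open>N'\<close>.
\<close>

lemma ex_conjugator:
  fixes N N' :: "'k::field_char_0 pdo"
  assumes N: "pdo_ord_le (N - pdo_mon 1 1) (- 1)" and N': "pdo_ord_le (N' - pdo_mon 1 1) (- 1)"
    and res: "\<And>m. pdo_res (N ^ m) = pdo_res (N' ^ m)"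
  shows "\<exists>S. pdo_ord_le (S - 1) (- 1) \<and> N * S = S * N'"
proof -
  have mon: "pdo_monic N 1" "pdo_monic N' 1"
    using monic_if_lower[OF monic_del[of 1] ord_le_mono[OF N]]
      monic_if_lower[OF monic_del[of 1] ord_le_mono[OF N']] by simp_all
  let ?P = "\<lambda>m S. pdo_ord_le (S - 1) (- 1) \<and> pdo_ord_le (N * S - S * N') (- 1 - int m)"
  have "\<exists>X. \<forall>m. ?P m (X m) \<and> pdo_ord_le (X (Suc m) - X m) (- 1 - int m)"
  proof (rule dependent_nat_choice)
    show "\<exists>S. ?P 0 S"
      by (rule exI[of _ 1]) (use ord_le_diff[OF N N'] in simp)
  next
    fix S :: "'k pdo" and m
    let ?k = "- 1 - int m"
    assume P: "?P m S"
    then have S1: "pdo_ord_le (S - 1) (- 1)" and low: "pdo_ord_le (N * S - S * N') ?k" by auto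
    have S: "pdo_monic S 0" using monic_if_lower[OF monic_one, of S] S1 by simp
    note nz = monic_nonzero[OF S]
    have S': "pdo_monic (inverse S) 0" using monic_inverse[OF S] by simp
    define A where "A = inverse S * N * S"
    have A: "pdo_monic A 1" unfolding A_def using monic_mult[OF monic_mult[OF S' mon(1)] S] by simp
    have AN': "A - N' = inverse S * (N * S - S * N')"
      using nz by (simp add: A_def right_diff_distrib flip: mult.assoc)
    have AN'_ord: "pdo_ord_le (A - N') ?k"
      unfolding AN' by (rule ord_le_mult[OF pdo_monicD(1)[OF S'] low]) simp
    have AN'_coeff: "pdo_coeff (A - N') ?k = pdo_coeff (N * S - S * N') ?k"
      unfolding AN' using coeff_mult_top[OF pdo_monicD(1)[OF S'] low] pdo_monicD(2)[OF S'] by simp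
    let ?c = "pdo_coeff (N * S - S * N') ?k"
    have k: "?k + int (Suc m) - 1 = - 1" by simp
    have "pdo_res (A ^ Suc m) = pdo_res (N' ^ Suc m)"
      using powi_conjugate[OF nz, of N "int (Suc m)"] pdo_res_conjugate[OF nz, of "N ^ Suc m"]
        res[of "Suc m"]
      unfolding A_def power_int_of_nat by simp
    then have "fls_residue (pdo_coeff (A ^ Suc m - N' ^ Suc m) (- 1)) = 0"
      by (simp add: pdo_res_def)
    also have "pdo_coeff (A ^ Suc m - N' ^ Suc m) (- 1) = of_nat (Suc m) * ?c"
      using monic_power_diff[OF A mon(2) AN'_ord, of "Suc m"] unfolding k AN'_coeff by blast
    finally have "of_nat (Suc m) * fls_residue ?c = 0"
      unfolding fls_of_nat fls_residue_fls_const_times .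
    then have "fls_residue (- ?c) = 0" by (simp del: of_nat_Suc)
    then obtain s where s: "fls_deriv s = - ?c"
      using fls_residue_nonzero_ex_antiderivative by blast
    let ?T = "pdo_mon s ?k"
    have "N * (S + ?T) - (S + ?T) * N' - (N * ?T - ?T * N' - pdo_mon (fls_deriv s) ?k)
      = (N * S - S * N') + pdo_mon (fls_deriv s) ?k"
      by (simp add: algebra_simps)
    moreover have "pdo_ord_le (N * ?T - ?T * N' - pdo_mon (fls_deriv s) ?k) (?k - 1)"
      by (rule ord_le_commutator_del_mon[OF N N'])
    moreover have "pdo_ord_le ((N * S - S * N') + pdo_mon (fls_deriv s) ?k) (?k - 1)"
      using low by (intro ord_le_lower ord_le_add ord_le_mon) (simp_all add: coeff_mon s)
    ultimately have "pdo_ord_le (N * (S + ?T) - (S + ?T) * N') (?k - 1)"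
      by (metis add_diff_cancel_right' diff_add_cancel ord_le_add)
    moreover have "pdo_ord_le (S + ?T - 1) (- 1)"
      using ord_le_add[OF S1 ord_le_mon[of ?k "- 1" s]] by (simp add: algebra_simps)
    moreover have "pdo_ord_le (S + ?T - S) ?k" by (simp add: ord_le_mon)
    ultimately show "\<exists>S'. ?P (Suc m) S' \<and> pdo_ord_le (S' - S) ?k"
      by (intro exI[of _ "S + ?T"]) (simp add: algebra_simps)
  qed
  then obtain X where X: "\<And>m. ?P m (X m)"
    and step: "\<And>m. pdo_ord_le (X (Suc m) - X m) (- 1 - int m)" by blast
  obtain S where S: "\<And>m. pdo_ord_le (S - X m) (- 1 - int m)"
    using ord_le_limit[OF step] by blast
  have "pdo_ord_le (S - 1) (- 1)"
    using ord_le_add[OF S[of 0, simplified] conjunct1[OF X[of 0]]] by simp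
  moreover have "N * S - S * N' = 0"
  proof (rule zero_if_ord_le_all)
    fix m
    have "N * S - S * N' = (N * X m - X m * N') + (N * (S - X m) - (S - X m) * N')"
      by (simp add: algebra_simps)
    moreover have "pdo_ord_le (N * X m - X m * N') (0 - int m)"
      using conjunct2[OF X] by (rule ord_le_mono) simp
    moreover have "pdo_ord_le (N * (S - X m)) (0 - int m)" "pdo_ord_le ((S - X m) * N') (0 - int m)"
      by (auto intro: ord_le_mult[OF pdo_monicD(1)[OF mon(1)] S]
          ord_le_mult[OF S pdo_monicD(1)[OF mon(2)]])
    ultimately show "pdo_ord_le (N * S - S * N') (0 - int m)"
      by (simp add: ord_le_add ord_le_diff)
  qed
  ultimately show ?thesis by auto
qed

theorem theorem2:
  fixes L M :: "'k::field_char_0 pdo"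
  assumes "pdo_ord L \<noteq> 0" and "pdo_ord M \<noteq> 0"
    and "\<exists>R. pdo_ord_less R (pdo_ord L - 1) \<and> L = pdo_del (pdo_ord L) + R"
    and "\<exists>R. pdo_ord_less R (pdo_ord M - 1) \<and> M = pdo_del (pdo_ord M) + R"
  shows "(\<exists>S. (\<exists>R\<in>pdo_neg. S = 1 + R) \<and> M = inverse S * L * S) \<longleftrightarrow>
    (pdo_ord L = pdo_ord M \<and>
      (\<forall>q\<in>{of_int j / of_int (pdo_ord L) | j :: int. True}.
        pdo_res (pdo_powq L q) = pdo_res (pdo_powq M q)))"
proof -
  have normal: "pdo_monic A (pdo_ord A) \<and> pdo_coeff A (pdo_ord A - 1) = 0"
    if h: "\<exists>R. pdo_ord_less R (pdo_ord A - 1) \<and> A = pdo_del (pdo_ord A) + R" for A :: "'k pdo"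
  proof -
    obtain R where R: "pdo_ord_le R (pdo_ord A - 1 - 1)" and A: "A = pdo_mon 1 (pdo_ord A) + R"
      using h unfolding ord_less_iff del_eq_mon by blast
    have "A - pdo_mon 1 (pdo_ord A) = R"
      unfolding diff_eq_eq by (subst add.commute) (rule A)
    with R have le: "pdo_ord_le (A - pdo_mon 1 (pdo_ord A)) (pdo_ord A - 2)" by simp
    have "pdo_monic A (pdo_ord A)"
      by (rule monic_if_lower[OF monic_del ord_le_mono[OF le]]) simp
    moreover have "pdo_coeff A (pdo_ord A - 1) = 0"
      using ord_leD[OF le, of "pdo_ord A - 1"] by (simp add: coeff_mon)
    ultimately show ?thesis ..
  qed
  define r where "r = pdo_ord L"
  have r: "r \<noteq> 0" using assms(1) by (simp add: r_def)
  have L: "pdo_monic L r" "pdo_coeff L (r - 1) = 0" using normal[OF assms(3)] by (auto simp: r_def)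
  let ?N = "pdo_root L" and ?N' = "pdo_root M"
  have neg: "(\<exists>R\<in>pdo_neg. S = 1 + R) \<longleftrightarrow> pdo_ord_le (S - 1) (- 1)" for S :: "'k pdo"
    unfolding pdo_neg_def ord_less_iff
    by (auto intro: bexI[of _ "S - 1"])
  have q: "(\<forall>q\<in>{of_int j / of_int (pdo_ord L) | j :: int. True}.
        pdo_res (pdo_powq L q) = pdo_res (pdo_powq M q)) \<longleftrightarrow>
      (\<forall>j. pdo_res (?N powi j) = pdo_res (?N' powi j))" if "pdo_monic M r"
    using pdo_powq_eq[OF L(1) r] pdo_powq_eq[OF that r] by (auto simp flip: r_def)
  show ?thesis unfolding neg
  proof
    assume "\<exists>S. pdo_ord_le (S - 1) (- 1) \<and> M = inverse S * L * S"
    then obtain S where S: "pdo_ord_le (S - 1) (- 1)" and M: "M = inverse S * L * S" by blast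
    have S0: "pdo_monic S 0" using monic_if_lower[OF monic_one, of S] S by simp
    note nz = monic_nonzero[OF S0]
    have S0': "pdo_monic (inverse S) 0" using monic_inverse[OF S0] by simp
    have conj: "pdo_monic (inverse S * A * S) m" if "pdo_monic A m" for A m
      using monic_mult[OF monic_mult[OF S0' that] S0] by simp
    have Mr: "pdo_monic M r" unfolding M by (rule conj[OF L(1)])
    have "?N' = inverse S * ?N * S"
      using pdo_root[OF L(1) r] by (intro pdo_root_eqI[OF Mr r] conj)
         (simp_all add: powi_conjugate[OF nz] M)
    then have "pdo_res (?N powi j) = pdo_res (?N' powi j)" for j
      by (simp add: powi_conjugate[OF nz] pdo_res_conjugate[OF nz])
    then show "pdo_ord L = pdo_ord M \<and> (\<forall>q\<in>{of_int j / of_int (pdo_ord L) | j :: int. True}.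
        pdo_res (pdo_powq L q) = pdo_res (pdo_powq M q))"
      unfolding q[OF Mr] using monic_ord[OF Mr] by (simp add: r_def)
  next
    assume ii: "pdo_ord L = pdo_ord M \<and> (\<forall>q\<in>{of_int j / of_int (pdo_ord L) | j :: int. True}.
        pdo_res (pdo_powq L q) = pdo_res (pdo_powq M q))"
    then have M: "pdo_monic M r" "pdo_coeff M (r - 1) = 0"
      using normal[OF assms(4)] by (auto simp: r_def)
    from ii have "\<forall>j. pdo_res (?N powi j) = pdo_res (?N' powi j)" unfolding q[OF M(1)] ..
    then have "pdo_res (?N ^ m) = pdo_res (?N' ^ m)" for m
      by (metis power_int_of_nat)
    from ex_conjugator[OF root_no_constant_term[OF L(1) r L(2)] root_no_constant_term[OF M(1) r M(2)] this]
    obtain S where S: "pdo_ord_le (S - 1) (- 1)" and comm: "?N * S = S * ?N'" by blast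
    have nz: "S \<noteq> 0" using monic_nonzero monic_if_lower[OF monic_one, of S] S by simp
    have "?N' = inverse S * ?N * S" using nz comm by (simp add: mult.assoc) (simp flip: mult.assoc)
    then have "?N' powi r = inverse S * ?N powi r * S" by (simp add: powi_conjugate[OF nz])
    then have "M = inverse S * L * S"
      by (simp only: pdo_root(2)[OF L(1) r] pdo_root(2)[OF M(1) r])
    with S show "\<exists>S. pdo_ord_le (S - 1) (- 1) \<and> M = inverse S * L * S" by blast
  qed
qed

end
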